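(* Let $A$, $\Delta$, $\epsilon$, $S$ and $\mathrm{Hom}_A(\epsilon,\Delta)$ be the irrational rotation algebra and the modules defined in the context. For $s\in S$ let $a_s\in A$ be the unique element with $(a_s\otimes 1)\cdot s_{0,0}=s$, and for $\zeta\in \mathrm{Hom}_A(\epsilon,\Delta)$ and $s\in S$ put $$\langle \zeta, s\rangle := \bigl(\zeta\cdot(a_s\otimes 1)\bigr)^0_0 .$$ Then $S$ is a weak hopfish antipode with respect to the pairing $\langle\ ,\ \rangle$; that is: (i) $\langle\ ,\ \rangle:\mathrm{Hom}_A(\epsilon,\Delta)\times S\to\mathbb{C}$ is a non-degenerate, $A\otimes A$-tensorial dual pairing of $\mathrm{Hom}_A(\epsilon,\Delta)$ and $S$; (ii) as a left module over $A=A\otimes\mathbb{C}$ (acting through the first tensor factor of $A\otimes A$), $S$ is free of rank one.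
   Context: All tensor products without subscript are over $\mathbb{C}$. Fix $\lambda\in\mathbb{R}$ with $\lambda/2\pi$ irrational. The algebra $A$: the unital associative $\mathbb{C}$-algebra with basis $\{a_{n,l} : n,l\in\mathbb{Z}\}$ and product $a_{n_1,l_1}a_{n_2,l_2}=e^{i\lambda n_1 l_2}a_{n_1+n_2,\,l_1+l_2}$; its unit is $a_{0,0}$. The $(A\otimes A,A)$-bimodule $\Delta$ has $\mathbb{C}$-basis $\{d_{n_1,n_2,l}: n_1,n_2,l\in\mathbb{Z}\}$ with right action $$d_{n_1,n_2,l}\cdot a_{m,j}=e^{i\lambda m(l-j)}\,d_{n_1+m,\,n_2+m,\,l-j}$$ and left action $$(a_{m_1,j_1}\otimes a_{m_2,j_2})\cdot d_{n_1,n_2,l}=e^{-i\lambda[(n_1+m_1)j_1+(n_2+m_2)j_2]}\,d_{n_1+m_1,\,n_2+m_2,\,l-j_1-j_2}.$$ The right $A$-module $\epsilon$ has $\mathbb{C}$-basis $\{e_l: l\in\mathbb{Z}\}$ with $e_l\cdot a_{m,j}=e^{i\lambda m(l-j)}e_{l-j}$. The left $A\otimes A$-module $S$ has $\mathbb{C}$-basis $\{s_{n,l}: n,l\in\mathbb{Z}\}$ with $$(a_{m_1,j_1}\otimes a_{m_2,j_2})\cdot s_{n,l}=e^{i\lambda m_1 l}\,e^{i\lambda(n+m_1-m_2)j_2}\,s_{n+m_1-m_2,\;l+j_1+j_2}.$$ In particular $(a_{m,j}\otimes1)\cdot s_{0,0}=s_{m,j}$, so $a_s$ is well defined. $\mathrm{Hom}_A(\epsilon,\Delta)$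 denotes the space of right $A$-linear maps $\zeta:\Delta\to\epsilon$ (from $\Delta$ to $\epsilon$). It is a right $A\otimes A$-module by $(\zeta\cdot(a\otimes b))(d):=\zeta((a\otimes b)\cdot d)$. The matrix elements $\zeta^l_n\in\mathbb{C}$ of $\zeta$ are defined by $\zeta(d_{n,0,0})=\sum_l\zeta^l_n e_l$ (a finite sum for each $n$). A dual pairing of complex vector spaces $U,V$ is a $\mathbb{C}$-bilinear map $\langle\ ,\ \rangle:U\times V\to\mathbb{C}$. If $U$ is a right and $V$ a left module over a unital algebra $B$, it is $B$-tensorial if $\langle u\cdot b,v\rangle=\langle u,b\cdot v\rangle$ for all $u\in U,v\in V,b\in B$. It is non-degenerate if ($\langle u,v\rangle=0$ for all $v$ implies $u=0$) and ($\langle u,v\rangle=0$ for all $u$ implies $v=0$). A left $A\otimes A$-module is a weak hopfish antipode if it has a non-degenerate $A\otimes A$-tensorial dual pairing with $\mathrm{Hom}_A(\epsilon,\Delta)$ and is free of rank one as a left $A\otimes\mathbb{C}$-module. *)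

theory Defs
  imports
    Complex_Main
    "HOL-Library.Poly_Mapping"
    "HOL-Library.Function_Algebras"
begin

section \<open>Complex vector spaces with a given basis\<close>

text \<open>
  The complex vector space with basis indexed by a type \<open>'i\<close> is modelled by the
  finitely supported functions \<open>'i \<Rightarrow>\<^sub>0 complex\<close>.  The convolution product
  that the library puts on this type plays no role here.
\<close>

definition cscale :: "complex \<Rightarrow> ('i \<Rightarrow>\<^sub>0 complex) \<Rightarrow> ('i \<Rightarrow>\<^sub>0 complex)"
  where "cscale c v = Poly_Mapping.map ((*) c) v"

abbreviation basis_vec :: "'i \<Rightarrow> ('i \<Rightarrow>\<^sub>0 complex)"
  where "basis_vec i \<equiv> Poly_Mapping.single i 1"

definition bilinear_extension ::
  "('i \<Rightarrow> 'j \<Rightarrow> ('k \<Rightarrow>\<^sub>0 complex)) \<Rightarrow> ('i \<Rightarrow>\<^sub>0 complex) \<Rightarrow> ('j \<Rightarrow>\<^sub>0 complex) \<Rightarrow> ('k \<Rightarrow>\<^sub>0 complex)"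
  where "bilinear_extension \<beta> v w =
    (\<Sum>i\<in>Poly_Mapping.keys v. \<Sum>j\<in>Poly_Mapping.keys w.
       cscale (Poly_Mapping.lookup v i * Poly_Mapping.lookup w j) (\<beta> i j))"

text \<open>
  The tensor product over the complex numbers of two spaces with bases indexed by
  \<open>'i\<close> and \<open>'j\<close> is the space with basis indexed by \<open>'i \<times> 'j\<close>.
\<close>

definition tensor ::
  "('i \<Rightarrow>\<^sub>0 complex) \<Rightarrow> ('j \<Rightarrow>\<^sub>0 complex) \<Rightarrow> ('i \<times> 'j \<Rightarrow>\<^sub>0 complex)"
  where "tensor = bilinear_extension (\<lambda>i j. basis_vec (i, j))"

lemma lookup_cscale [simp]: "Poly_Mapping.lookup (cscale c v) i = c * Poly_Mapping.lookup v i"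
  unfolding cscale_def by transfer (auto simp: when_def)

lemma vector_space_cscale: "vector_space cscale"
  by unfold_locales (auto intro!: poly_mapping_eqI simp: lookup_add algebra_simps)

interpretation cs: vector_space cscale
  by (rule vector_space_cscale)

lemma cscale_single [simp]: "cscale c (Poly_Mapping.single i x) = Poly_Mapping.single i (c * x)"
  by (rule poly_mapping_eqI) (simp add: lookup_single when_def)

lemma bilinear_extension_superset:
  assumes "finite I" "finite J" "Poly_Mapping.keys v \<subseteq> I" "Poly_Mapping.keys w \<subseteq> J"
  shows "bilinear_extension \<beta> v w =
    (\<Sum>i\<in>I. \<Sum>j\<in>J. cscale (Poly_Mapping.lookup v i * Poly_Mapping.lookup w j) (\<beta> i j))"
proof -
  have "(\<Sum>j\<in>Poly_Mapping.keys w. cscale (Poly_Mapping.lookup v i * Poly_Mapping.lookup w j) (\<beta> i j)) =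
      (\<Sum>j\<in>J. cscale (Poly_Mapping.lookup v i * Poly_Mapping.lookup w j) (\<beta> i j))" for i
    by (rule sum.mono_neutral_left) (use assms in \<open>auto simp: in_keys_iff\<close>)
  then have "bilinear_extension \<beta> v w = (\<Sum>i\<in>Poly_Mapping.keys v.
      \<Sum>j\<in>J. cscale (Poly_Mapping.lookup v i * Poly_Mapping.lookup w j) (\<beta> i j))"
    unfolding bilinear_extension_def by simp
  also have "\<dots> = (\<Sum>i\<in>I. \<Sum>j\<in>J.
      cscale (Poly_Mapping.lookup v i * Poly_Mapping.lookup w j) (\<beta> i j))"
    by (rule sum.mono_neutral_left) (use assms in \<open>auto simp: in_keys_iff\<close>)
  finally show ?thesis .
qed

lemma bilinear_extension_add_left [simp]:
  "bilinear_extension \<beta> (v + v') w = bilinear_extension \<beta> v w + bilinear_extension \<beta> v' w"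
proof -
  let ?I = "Poly_Mapping.keys v \<union> Poly_Mapping.keys v'" and ?J = "Poly_Mapping.keys w"
  have "Poly_Mapping.keys (v + v') \<subseteq> ?I" by (rule Poly_Mapping.keys_add)
  then show ?thesis
    by (simp add: bilinear_extension_superset[of ?I ?J] lookup_add algebra_simps
        cs.scale_left_distrib sum.distrib)
qed

lemma bilinear_extension_add_right [simp]:
  "bilinear_extension \<beta> v (w + w') = bilinear_extension \<beta> v w + bilinear_extension \<beta> v w'"
proof -
  let ?J = "Poly_Mapping.keys w \<union> Poly_Mapping.keys w'" and ?I = "Poly_Mapping.keys v"
  have "Poly_Mapping.keys (w + w') \<subseteq> ?J" by (rule Poly_Mapping.keys_add)
  then show ?thesis
    by (simp add: bilinear_extension_superset[of ?I ?J] lookup_add algebra_simps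
        cs.scale_left_distrib sum.distrib)
qed

lemma keys_cscale: "Poly_Mapping.keys (cscale c v) \<subseteq> Poly_Mapping.keys v"
  by (auto simp: in_keys_iff)

lemma bilinear_extension_scale_left [simp]:
  "bilinear_extension \<beta> (cscale c v) w = cscale c (bilinear_extension \<beta> v w)"
  by (simp add: bilinear_extension_superset[of "Poly_Mapping.keys v" "Poly_Mapping.keys w"]
      keys_cscale cs.scale_sum_right mult.assoc)

lemma bilinear_extension_scale_right [simp]:
  "bilinear_extension \<beta> v (cscale c w) = cscale c (bilinear_extension \<beta> v w)"
  by (simp add: bilinear_extension_superset[of "Poly_Mapping.keys v" "Poly_Mapping.keys w"]
      keys_cscale cs.scale_sum_right mult.left_commute)

lemma bilinear_extension_single [simp]:
  "bilinear_extension \<beta> (Poly_Mapping.single i x) (Poly_Mapping.single j y) = cscale (x * y) (\<beta> i j)"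
  by (simp add: bilinear_extension_superset[of "{i}" "{j}"])

lemma basis_induct [case_names basis add scale]:
  fixes v :: "'i \<Rightarrow>\<^sub>0 complex"
  assumes basis: "\<And>i. P (basis_vec i)"
    and add: "\<And>v w. P v \<Longrightarrow> P w \<Longrightarrow> P (v + w)"
    and scale: "\<And>c v. P v \<Longrightarrow> P (cscale c v)"
  shows "P v"
proof -
  have "P (\<Sum>i\<in>I. cscale (Poly_Mapping.lookup v i) (basis_vec i))" if "finite I" for I
    using that
  proof induction
    case empty
    have "P (cscale 0 (basis_vec undefined))" by (intro basis scale)
    then show ?case by (simp del: cscale_single)
  next
    case (insert i I)
    then show ?case by (simp add: basis add scale del: cscale_single)
  qed
  moreover have "v = (\<Sum>i\<in>Poly_Mapping.keys v. cscale (Poly_Mapping.lookup v i) (basis_vec i))"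
    by (rule poly_mapping_eqI)
      (auto simp: lookup_sum lookup_single when_def in_keys_iff sum.delta')
  ultimately show ?thesis by (metis finite_keys)
qed

definition fun_scale :: "(complex \<Rightarrow> 'v \<Rightarrow> 'v) \<Rightarrow> complex \<Rightarrow> ('u \<Rightarrow> 'v) \<Rightarrow> ('u \<Rightarrow> 'v)"
  where "fun_scale s c f = (\<lambda>x. s c (f x))"

lemma vector_space_fun_scale: "vector_space s \<Longrightarrow> vector_space (fun_scale s)"
  unfolding vector_space_def by (simp add: fun_scale_def fun_eq_iff)


section \<open>Modules over noncommutative complex algebras\<close>

locale unital_algebra = vector_space scale
  for scale :: "complex \<Rightarrow> 'b::ab_group_add \<Rightarrow> 'b" +
  fixes mul :: "'b \<Rightarrow> 'b \<Rightarrow> 'b" and unit :: 'b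
  assumes linear_mul_left: "Vector_Spaces.linear scale scale (\<lambda>a. mul a b)"
    and linear_mul_right: "Vector_Spaces.linear scale scale (mul a)"
    and mul_assoc: "mul (mul a b) c = mul a (mul b c)"
    and unit_left: "mul unit a = a"
    and unit_right: "mul a unit = a"

locale left_module = unital_algebra scaleB mul unit + V: vector_space scaleV
  for scaleB :: "complex \<Rightarrow> 'b::ab_group_add \<Rightarrow> 'b"
    and mul :: "'b \<Rightarrow> 'b \<Rightarrow> 'b" and unit :: 'b
    and scaleV :: "complex \<Rightarrow> 'v::ab_group_add \<Rightarrow> 'v" +
  fixes act :: "'b \<Rightarrow> 'v \<Rightarrow> 'v"
  assumes linear_act_left: "Vector_Spaces.linear scaleB scaleV (\<lambda>b. act b v)"
    and linear_act_right: "Vector_Spaces.linear scaleV scaleV (act b)"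
    and act_mul: "act (mul a b) v = act a (act b v)"
    and act_unit: "act unit v = v"

text \<open>
  Right modules are given on a subspace \<open>U\<close> of an ambient type, because the space of
  right \<open>A\<close>-linear maps depends on a parameter and hence is not a type of its own.
\<close>

locale right_module_on = unital_algebra scaleB mul unit + U: vector_space scaleU
  for scaleB :: "complex \<Rightarrow> 'b::ab_group_add \<Rightarrow> 'b"
    and mul :: "'b \<Rightarrow> 'b \<Rightarrow> 'b" and unit :: 'b
    and scaleU :: "complex \<Rightarrow> 'u::ab_group_add \<Rightarrow> 'u" +
  fixes U :: "'u set" and act :: "'u \<Rightarrow> 'b \<Rightarrow> 'u"
  assumes subspace_U: "U.subspace U"
    and act_closed: "u \<in> U \<Longrightarrow> act u b \<in> U"
    and act_add_left: "u \<in> U \<Longrightarrow> u' \<in> U \<Longrightarrow> act (u + u') b = act u b + act u' b"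
    and act_scale_left: "u \<in> U \<Longrightarrow> act (scaleU c u) b = scaleU c (act u b)"
    and linear_act_right: "u \<in> U \<Longrightarrow> Vector_Spaces.linear scaleB scaleU (act u)"
    and act_mul: "u \<in> U \<Longrightarrow> act u (mul a b) = act (act u a) b"
    and act_unit: "u \<in> U \<Longrightarrow> act u unit = u"

definition dual_pairing ::
  "(complex \<Rightarrow> 'u::ab_group_add \<Rightarrow> 'u) \<Rightarrow> 'u set \<Rightarrow> (complex \<Rightarrow> 'v::ab_group_add \<Rightarrow> 'v) \<Rightarrow>
   ('u \<Rightarrow> 'v \<Rightarrow> complex) \<Rightarrow> bool"
  where "dual_pairing scaleU U scaleV p \<longleftrightarrow>
    (\<forall>u\<in>U. \<forall>u'\<in>U. \<forall>v. p (u + u') v = p u v + p u' v) \<and>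
    (\<forall>c. \<forall>u\<in>U. \<forall>v. p (scaleU c u) v = c * p u v) \<and>
    (\<forall>u\<in>U. Vector_Spaces.linear scaleV (*) (p u))"

definition tensorial ::
  "'u set \<Rightarrow> ('u \<Rightarrow> 'b \<Rightarrow> 'u) \<Rightarrow> ('b \<Rightarrow> 'v \<Rightarrow> 'v) \<Rightarrow> ('u \<Rightarrow> 'v \<Rightarrow> complex) \<Rightarrow> bool"
  where "tensorial U ract lact p \<longleftrightarrow> (\<forall>u\<in>U. \<forall>v b. p (ract u b) v = p u (lact b v))"

definition nondegenerate ::
  "'u::zero set \<Rightarrow> ('u \<Rightarrow> 'v::zero \<Rightarrow> complex) \<Rightarrow> bool"
  where "nondegenerate U p \<longleftrightarrow>
    (\<forall>u\<in>U. (\<forall>v. p u v = 0) \<longrightarrow> u = 0) \<and>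
    (\<forall>v. (\<forall>u\<in>U. p u v = 0) \<longrightarrow> v = 0)"

definition free_of_rank :: "('b::zero \<Rightarrow> 'v::ab_group_add \<Rightarrow> 'v) \<Rightarrow> nat \<Rightarrow> bool"
  where "free_of_rank act n \<longleftrightarrow>
    (\<exists>E. finite E \<and> card E = n \<and>
      (\<forall>v. \<exists>!c. (\<forall>e. e \<notin> E \<longrightarrow> c e = 0) \<and> v = (\<Sum>e\<in>E. act (c e) e)))"


section \<open>The irrational rotation algebra and its modules\<close>

type_synonym rot = "int \<times> int \<Rightarrow>\<^sub>0 complex"
type_synonym rot2 = "(int \<times> int) \<times> (int \<times> int) \<Rightarrow>\<^sub>0 complex"
type_synonym rot_Delta = "int \<times> int \<times> int \<Rightarrow>\<^sub>0 complex"
type_synonym rot_eps = "int \<Rightarrow>\<^sub>0 complex"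
type_synonym rot_S = "int \<times> int \<Rightarrow>\<^sub>0 complex"

text \<open>The abbreviation \<open>phase lam k\<close> is the scalar \<open>exp (\<i> lam k)\<close>.\<close>

abbreviation phase :: "real \<Rightarrow> int \<Rightarrow> complex"
  where "phase lam k \<equiv> cis (lam * of_int k)"

definition A_mul :: "real \<Rightarrow> rot \<Rightarrow> rot \<Rightarrow> rot"
  where "A_mul lam = bilinear_extension (\<lambda>(n1, l1) (n2, l2).
    cscale (phase lam (n1 * l2)) (basis_vec (n1 + n2, l1 + l2)))"

definition A_one :: rot
  where "A_one = basis_vec (0, 0)"

definition AA_mul :: "real \<Rightarrow> rot2 \<Rightarrow> rot2 \<Rightarrow> rot2"
  where "AA_mul lam = bilinear_extension (\<lambda>(p, p') (q, q').
    tensor (A_mul lam (basis_vec p) (basis_vec q)) (A_mul lam (basis_vec p') (basis_vec q')))"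

definition AA_one :: rot2
  where "AA_one = tensor A_one A_one"

definition Delta_ract :: "real \<Rightarrow> rot_Delta \<Rightarrow> rot \<Rightarrow> rot_Delta"
  where "Delta_ract lam = bilinear_extension (\<lambda>(n1, n2, l) (m, j).
    cscale (phase lam (m * (l - j))) (basis_vec (n1 + m, n2 + m, l - j)))"

definition Delta_lact :: "real \<Rightarrow> rot2 \<Rightarrow> rot_Delta \<Rightarrow> rot_Delta"
  where "Delta_lact lam = bilinear_extension (\<lambda>((m1, j1), (m2, j2)) (n1, n2, l).
    cscale (phase lam (- ((n1 + m1) * j1 + (n2 + m2) * j2)))
      (basis_vec (n1 + m1, n2 + m2, l - j1 - j2)))"

definition eps_ract :: "real \<Rightarrow> rot_eps \<Rightarrow> rot \<Rightarrow> rot_eps"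
  where "eps_ract lam = bilinear_extension (\<lambda>l (m, j).
    cscale (phase lam (m * (l - j))) (basis_vec (l - j)))"

definition S_lact :: "real \<Rightarrow> rot2 \<Rightarrow> rot_S \<Rightarrow> rot_S"
  where "S_lact lam = bilinear_extension (\<lambda>((m1, j1), (m2, j2)) (n, l).
    cscale (phase lam (m1 * l) * phase lam ((n + m1 - m2) * j2))
      (basis_vec (n + m1 - m2, l + j1 + j2)))"

text \<open>
  Despite the order of the arguments in the traditional notation
  \<open>Hom\<^sub>A(\<epsilon>, \<Delta>)\<close>, its elements are maps from \<open>\<Delta>\<close> to \<open>\<epsilon>\<close>.
\<close>

definition Hom_eps_Delta :: "real \<Rightarrow> (rot_Delta \<Rightarrow> rot_eps) set"
  where "Hom_eps_Delta lam = {\<zeta>. Vector_Spaces.linear cscale cscale \<zeta> \<and>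
    (\<forall>d a. \<zeta> (Delta_ract lam d a) = eps_ract lam (\<zeta> d) a)}"

definition Hom_ract :: "real \<Rightarrow> (rot_Delta \<Rightarrow> rot_eps) \<Rightarrow> rot2 \<Rightarrow> (rot_Delta \<Rightarrow> rot_eps)"
  where "Hom_ract lam \<zeta> t = (\<lambda>d. \<zeta> (Delta_lact lam t d))"

text \<open>\<open>matrix_element \<zeta> l n\<close> has upper index \<open>l\<close> and lower index \<open>n\<close>.\<close>

definition matrix_element :: "(rot_Delta \<Rightarrow> rot_eps) \<Rightarrow> int \<Rightarrow> int \<Rightarrow> complex"
  where "matrix_element \<zeta> l n = Poly_Mapping.lookup (\<zeta> (basis_vec (n, 0, 0))) l"

definition a_elem :: "real \<Rightarrow> rot_S \<Rightarrow> rot"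
  where "a_elem lam s = (THE a. S_lact lam (tensor a A_one) (basis_vec (0, 0)) = s)"

definition pairing :: "real \<Rightarrow> (rot_Delta \<Rightarrow> rot_eps) \<Rightarrow> rot_S \<Rightarrow> complex"
  where "pairing lam \<zeta> s = matrix_element (Hom_ract lam \<zeta> (tensor (a_elem lam s) A_one)) 0 0"

text \<open>
  In the last conjunct \<open>A\<close>, identified with \<open>A \<otimes> \<complex>\<close>, acts through the first
  tensor factor.
\<close>

definition weak_hopfish_antipode ::
  "real \<Rightarrow> (complex \<Rightarrow> 'v::ab_group_add \<Rightarrow> 'v) \<Rightarrow> (rot2 \<Rightarrow> 'v \<Rightarrow> 'v) \<Rightarrow>
   ((rot_Delta \<Rightarrow> rot_eps) \<Rightarrow> 'v \<Rightarrow> complex) \<Rightarrow> bool"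
  where "weak_hopfish_antipode lam scaleV act p \<longleftrightarrow>
    left_module cscale (AA_mul lam) AA_one scaleV act \<and>
    dual_pairing (fun_scale cscale) (Hom_eps_Delta lam) scaleV p \<and>
    tensorial (Hom_eps_Delta lam) (Hom_ract lam) act p \<and>
    nondegenerate (Hom_eps_Delta lam) p \<and>
    free_of_rank (\<lambda>a. act (tensor a A_one)) 1"


section \<open>Well-definedness of the structures\<close>

lemma unital_algebra_A: "unital_algebra cscale (A_mul lam) A_one"
proof unfold_locales
  fix a b c
  show "A_mul lam (A_mul lam a b) c = A_mul lam a (A_mul lam b c)"
  proof (induction a rule: basis_induct)
    case (basis p)
    show ?case
    proof (induction b rule: basis_induct)
      case (basis q)
      show ?case
        by (induction c rule: basis_induct)
          (auto simp: A_mul_def cis_mult algebra_simps split: prod.split)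
    qed (simp_all add: A_mul_def)
  qed (simp_all add: A_mul_def)
  show "A_mul lam A_one a = a"
    by (induction a rule: basis_induct) (auto simp: A_mul_def A_one_def)
  show "A_mul lam a A_one = a"
    by (induction a rule: basis_induct) (auto simp: A_mul_def A_one_def)
qed (simp_all add: A_mul_def)

lemma tensor_mul:
  "AA_mul lam (tensor a b) (tensor a' b') = tensor (A_mul lam a a') (A_mul lam b b')"
proof (induction a rule: basis_induct)
  case (basis p)
  show ?case
  proof (induction b rule: basis_induct)
    case (basis q)
    show ?case
    proof (induction a' rule: basis_induct)
      case (basis p')
      show ?case
        by (induction b' rule: basis_induct)
          (auto simp: AA_mul_def A_mul_def tensor_def)
    qed (simp_all add: AA_mul_def A_mul_def tensor_def)
  qed (simp_all add: AA_mul_def A_mul_def tensor_def)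
qed (simp_all add: AA_mul_def A_mul_def tensor_def)

lemma unital_algebra_AA: "unital_algebra cscale (AA_mul lam) AA_one"
proof unfold_locales
  fix a b c
  show "AA_mul lam (AA_mul lam a b) c = AA_mul lam a (AA_mul lam b c)"
  proof (induction a rule: basis_induct)
    case (basis p)
    show ?case
    proof (induction b rule: basis_induct)
      case (basis q)
      show ?case
        by (induction c rule: basis_induct)
          (auto simp: AA_mul_def A_mul_def tensor_def cis_mult algebra_simps split: prod.split)
    qed (simp_all add: AA_mul_def)
  qed (simp_all add: AA_mul_def)
  show "AA_mul lam AA_one a = a"
    by (induction a rule: basis_induct) (auto simp: AA_mul_def AA_one_def A_mul_def A_one_def tensor_def)
  show "AA_mul lam a AA_one = a"
    by (induction a rule: basis_induct) (auto simp: AA_mul_def AA_one_def A_mul_def A_one_def tensor_def)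
qed (simp_all add: AA_mul_def)

lemma right_module_Delta: "right_module_on cscale (A_mul lam) A_one cscale UNIV (Delta_ract lam)"
proof -
  interpret unital_algebra cscale "A_mul lam" A_one by (rule unital_algebra_A)
  show ?thesis
  proof unfold_locales
    fix d a b
    show "Delta_ract lam d (A_mul lam a b) = Delta_ract lam (Delta_ract lam d a) b"
    proof (induction a rule: basis_induct)
      case (basis p)
      show ?case
      proof (induction b rule: basis_induct)
        case (basis q)
        show ?case
          by (induction d rule: basis_induct)
            (auto simp: Delta_ract_def A_mul_def cis_mult algebra_simps split: prod.split)
      qed (simp_all add: Delta_ract_def A_mul_def)
    qed (simp_all add: Delta_ract_def A_mul_def)
    show "Delta_ract lam d A_one = d"
      by (induction d rule: basis_induct) (auto simp: Delta_ract_def A_one_def)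
  qed (simp_all add: Delta_ract_def)
qed

lemma left_module_Delta: "left_module cscale (AA_mul lam) AA_one cscale (Delta_lact lam)"
proof -
  interpret unital_algebra cscale "AA_mul lam" AA_one by (rule unital_algebra_AA)
  show ?thesis
  proof unfold_locales
    fix d a b
    show "Delta_lact lam (AA_mul lam a b) d = Delta_lact lam a (Delta_lact lam b d)"
    proof (induction a rule: basis_induct)
      case (basis p)
      show ?case
      proof (induction b rule: basis_induct)
        case (basis q)
        show ?case
          by (induction d rule: basis_induct)
            (auto simp: Delta_lact_def AA_mul_def A_mul_def tensor_def cis_mult algebra_simps
              split: prod.split)
      qed (simp_all add: Delta_lact_def AA_mul_def)
    qed (simp_all add: Delta_lact_def AA_mul_def)
    show "Delta_lact lam AA_one d = d"
      by (induction d rule: basis_induct) (auto simp: Delta_lact_def AA_one_def A_one_def tensor_def)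
  qed (simp_all add: Delta_lact_def)
qed

lemma bimodule_Delta:
  "Delta_lact lam t (Delta_ract lam d a) = Delta_ract lam (Delta_lact lam t d) a"
proof (induction t rule: basis_induct)
  case (basis p)
  show ?case
  proof (induction a rule: basis_induct)
    case (basis q)
    show ?case
      by (induction d rule: basis_induct)
        (auto simp: Delta_lact_def Delta_ract_def cis_mult algebra_simps split: prod.split)
  qed (simp_all add: Delta_lact_def Delta_ract_def)
qed (simp_all add: Delta_lact_def Delta_ract_def)

lemma right_module_eps: "right_module_on cscale (A_mul lam) A_one cscale UNIV (eps_ract lam)"
proof -
  interpret unital_algebra cscale "A_mul lam" A_one by (rule unital_algebra_A)
  show ?thesis
  proof unfold_locales
    fix d a b
    show "eps_ract lam d (A_mul lam a b) = eps_ract lam (eps_ract lam d a) b"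
    proof (induction a rule: basis_induct)
      case (basis p)
      show ?case
      proof (induction b rule: basis_induct)
        case (basis q)
        show ?case
          by (induction d rule: basis_induct)
            (auto simp: eps_ract_def A_mul_def cis_mult algebra_simps split: prod.split)
      qed (simp_all add: eps_ract_def A_mul_def)
    qed (simp_all add: eps_ract_def A_mul_def)
    show "eps_ract lam d A_one = d"
      by (induction d rule: basis_induct) (auto simp: eps_ract_def A_one_def)
  qed (simp_all add: eps_ract_def)
qed

lemma left_module_S: "left_module cscale (AA_mul lam) AA_one cscale (S_lact lam)"
proof -
  interpret unital_algebra cscale "AA_mul lam" AA_one by (rule unital_algebra_AA)
  show ?thesis
  proof unfold_locales
    fix d a b
    show "S_lact lam (AA_mul lam a b) d = S_lact lam a (S_lact lam b d)"
    proof (induction a rule: basis_induct)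
      case (basis p)
      show ?case
      proof (induction b rule: basis_induct)
        case (basis q)
        show ?case
          by (induction d rule: basis_induct)
            (auto simp: S_lact_def AA_mul_def A_mul_def tensor_def cis_mult algebra_simps
              split: prod.split)
      qed (simp_all add: S_lact_def AA_mul_def)
    qed (simp_all add: S_lact_def AA_mul_def)
    show "S_lact lam AA_one d = d"
      by (induction d rule: basis_induct) (auto simp: S_lact_def AA_one_def A_one_def tensor_def)
  qed (simp_all add: S_lact_def)
qed

lemma right_module_Hom:
  "right_module_on cscale (AA_mul lam) AA_one (fun_scale cscale) (Hom_eps_Delta lam) (Hom_ract lam)"
proof -
  interpret unital_algebra cscale "AA_mul lam" AA_one by (rule unital_algebra_AA)
  interpret V: vector_space "fun_scale cscale :: _ \<Rightarrow> (rot_Delta \<Rightarrow> rot_eps) \<Rightarrow> _"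
    by (rule vector_space_fun_scale) (rule vector_space_cscale)
  interpret D: left_module cscale "AA_mul lam" AA_one cscale "Delta_lact lam"
    by (rule left_module_Delta)
  have eps: "eps_ract lam 0 a = 0" for a
    by (simp add: eps_ract_def bilinear_extension_def)
  show ?thesis
  proof unfold_locales
    show "V.subspace (Hom_eps_Delta lam)"
      by (rule V.subspaceI)
        (auto simp: Hom_eps_Delta_def Vector_Spaces.linear_iff vector_space_cscale fun_scale_def
          eps cs.scale_right_distrib mult.commute, simp_all add: eps_ract_def)
    fix u :: "rot_Delta \<Rightarrow> rot_eps" and a b
    assume u: "u \<in> Hom_eps_Delta lam"
    have lin: "u (x + y) = u x + u y" "u (cscale c x) = cscale c (u x)" for x y c
      using u by (auto simp: Hom_eps_Delta_def Vector_Spaces.linear_iff)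
    show "Hom_ract lam u b \<in> Hom_eps_Delta lam"
      using u by (auto simp: Hom_eps_Delta_def Hom_ract_def Vector_Spaces.linear_iff bimodule_Delta
          vector_space_cscale) (simp_all add: Delta_lact_def)
    show "Hom_ract lam u (a + b) = Hom_ract lam u a + Hom_ract lam u b"
      by (rule ext) (simp add: Hom_ract_def Delta_lact_def lin)
    show "Hom_ract lam u (cscale c a) = fun_scale cscale c (Hom_ract lam u a)" for c
      by (rule ext) (simp add: Hom_ract_def Delta_lact_def fun_scale_def lin)
    show "Hom_ract lam u (AA_mul lam a b) = Hom_ract lam (Hom_ract lam u a) b"
      by (rule ext) (simp add: Hom_ract_def D.act_mul)
    show "Hom_ract lam u AA_one = u"
      by (rule ext) (simp add: Hom_ract_def D.act_unit)
  qed (simp_all add: Hom_ract_def fun_scale_def fun_eq_iff)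
qed

lemma a_elem_ex1: "\<exists>!a. S_lact lam (tensor a A_one) (basis_vec (0, 0)) = s"
proof -
  have "S_lact lam (tensor a A_one) (basis_vec (0, 0)) = a" for a
    by (induction a rule: basis_induct) (auto simp: S_lact_def tensor_def A_one_def)
  then show ?thesis by simp
qed

end

(* As a right A-module, \<Delta> is free on the vectors d_{n,0,0}: d_{n1,n2,l} is a unit multiple of
   d_{n1-n2,0,0} . a_{n2,-l}.  Hence a right A-linear map \<zeta> is determined by its matrix elements,
   and these can be prescribed freely subject to finiteness of each \<zeta>(d_{n,0,0}).  On the
   basis the pairing reads <\<zeta>, s_{m,j}> = exp(-i lam m j) \<zeta>^j_m, from which non-degeneracy is
   immediate; tensoriality is a comparison of phases. *)

theory Submission
  imports Defs
begin

lemma cis_mult_left: "cis x * (cis y * z) = cis (x + y) * z"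
  by (simp add: cis_mult flip: mult.assoc)

text \<open>At \<open>n = l = 0\<close> and \<open>m2 = j2 = 0\<close> both phases of the left
  action are 1, so \<open>a_{m,j}\<close> goes to \<open>s_{m,j}\<close>. Since \<open>rot\<close>
  and \<open>rot_S\<close> are the same type, this identification of A with S is literally the
  identity. It yields both \<open>a_elem\<close> and freeness.\<close>

lemma S_lact_tensor_one_generator: "S_lact lam (tensor a A_one) (basis_vec (0, 0)) = a"
  by (induction a rule: basis_induct) (auto simp: S_lact_def tensor_def A_one_def)

lemma a_elem_eq: "a_elem lam s = s"
  unfolding a_elem_def by (simp add: S_lact_tensor_one_generator)

lemma pairing_eq:
  "pairing lam \<zeta> s =
    Poly_Mapping.lookup (\<zeta> (Delta_lact lam (tensor s A_one) (basis_vec (0, 0, 0)))) 0"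
  by (simp add: pairing_def a_elem_eq matrix_element_def Hom_ract_def)

lemma lookup_eps_ract_basis:
  "Poly_Mapping.lookup (eps_ract lam e (basis_vec (m, j))) k =
    phase lam (m * k) * Poly_Mapping.lookup e (k + j)"
proof (induction e rule: basis_induct)
  case (basis l)
  show ?case
    by (auto simp: eps_ract_def lookup_single when_def)
qed (simp_all add: eps_ract_def lookup_add algebra_simps)

lemma
  assumes "\<zeta> \<in> Hom_eps_Delta lam"
  shows Hom_add: "\<zeta> (x + y) = \<zeta> x + \<zeta> y"
    and Hom_scale: "\<zeta> (cscale c x) = cscale c (\<zeta> x)"
    and Hom_Delta_ract: "\<zeta> (Delta_ract lam d a) = eps_ract lam (\<zeta> d) a"
  using assms by (auto simp: Hom_eps_Delta_def Vector_Spaces.linear_iff)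

lemma basis_Delta_eq:
  "basis_vec (n1, n2, l) =
    cscale (phase lam (- (n2 * l))) (Delta_ract lam (basis_vec (n1 - n2, 0, 0)) (basis_vec (n2, - l)))"
  by (simp add: Delta_ract_def cis_mult)

text \<open>Apply \<zeta> to \<open>basis_Delta_eq\<close>: acting by \<open>a_{n2,-l}\<close>
  shifts the coefficient index from \<open>k\<close> to \<open>k - l\<close> and contributes the
  phase of \<open>n2 * k\<close>, while the prefactor contributes that of
  \<open>- n2 * l\<close>.\<close>

lemma lookup_Hom_basis:
  assumes "\<zeta> \<in> Hom_eps_Delta lam"
  shows "Poly_Mapping.lookup (\<zeta> (basis_vec (n1, n2, l))) k =
    phase lam (n2 * (k - l)) * matrix_element \<zeta> (k - l) (n1 - n2)"
  unfolding basis_Delta_eq[of n1 n2 l lam]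
  by (simp add: Hom_scale[OF assms] Hom_Delta_ract[OF assms] lookup_eps_ract_basis
      matrix_element_def cis_mult cis_mult_left algebra_simps)

lemma pairing_basis:
  assumes "\<zeta> \<in> Hom_eps_Delta lam"
  shows "pairing lam \<zeta> (basis_vec (m, j)) = phase lam (- (m * j)) * matrix_element \<zeta> j m"
  \<comment> \<open>The left action turns \<open>d_{0,0,0}\<close> into the phase of
    \<open>- m * j\<close> times \<open>d_{m,0,-j}\<close>, whose coefficient at 0 is a matrix
    element. Keeping \<open>cscale\<close> on basis vectors lets \<open>Hom_scale\<close>
    match.\<close>
  by (simp add: pairing_eq Delta_lact_def tensor_def A_one_def Hom_scale[OF assms]
      lookup_Hom_basis[OF assms] del: cscale_single)

lemma pairing_add_right:
  assumes "\<zeta> \<in> Hom_eps_Delta lam"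
  shows "pairing lam \<zeta> (s + s') = pairing lam \<zeta> s + pairing lam \<zeta> s'"
  by (simp add: pairing_eq Delta_lact_def tensor_def Hom_add[OF assms] lookup_add)

lemma pairing_scale_right:
  assumes "\<zeta> \<in> Hom_eps_Delta lam"
  shows "pairing lam \<zeta> (cscale c s) = c * pairing lam \<zeta> s"
  by (simp add: pairing_eq Delta_lact_def tensor_def Hom_scale[OF assms])

lemma Hom_eqI:
  assumes "\<zeta> \<in> Hom_eps_Delta lam" and "\<zeta>' \<in> Hom_eps_Delta lam"
    and "\<And>l n. matrix_element \<zeta> l n = matrix_element \<zeta>' l n"
  shows "\<zeta> = \<zeta>'"
proof
  fix d
  show "\<zeta> d = \<zeta>' d"
  proof (induction d rule: basis_induct)
    case (basis i)
    show ?case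
      by (cases i) (auto intro!: poly_mapping_eqI
          simp: lookup_Hom_basis[OF assms(1)] lookup_Hom_basis[OF assms(2)] assms(3))
  qed (simp_all add: Hom_add[OF assms(1)] Hom_add[OF assms(2)]
      Hom_scale[OF assms(1)] Hom_scale[OF assms(2)])
qed

text \<open>
  The dummy second argument of type \<open>unit\<close> turns \<open>bilinear_extension\<close> into linear extension.
\<close>

definition elementary_Hom :: "real \<Rightarrow> int \<Rightarrow> int \<Rightarrow> rot_Delta \<Rightarrow> rot_eps"
  where "elementary_Hom lam j m d = bilinear_extension
    (\<lambda>(n1, n2, l) (_ :: unit).
      if n1 - n2 = m then cscale (phase lam (n2 * j)) (basis_vec (j + l)) else 0)
    d (basis_vec ())"

text \<open>The right action preserves \<open>n1 - n2\<close>, so the case split is respected. When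
  \<open>n2\<close> grows by \<open>p\<close>, the extra phase of \<open>p * j\<close> is exactly
  what the shift by \<open>j\<close> in \<epsilon> produces.\<close>

lemma elementary_Hom_in: "elementary_Hom lam j m \<in> Hom_eps_Delta lam"
proof -
  have "elementary_Hom lam j m (Delta_ract lam d a) = eps_ract lam (elementary_Hom lam j m d) a"
    for d a
  proof (induction a rule: basis_induct)
    case (basis p)
    \<comment> \<open>Settles the basis vectors with \<open>n1 - n2\<close> different from
      \<open>m\<close>; \<open>eps_ract\<close> stays folded in the first \<open>auto\<close> below
      so that this equation can fire.\<close>
    have zero: "eps_ract lam 0 a = 0" for a
      by (simp add: eps_ract_def bilinear_extension_def)
    show ?case
    proof (induction d rule: basis_induct)
      case (basis q)
      show ?case
        by (cases p; cases q)
          (auto simp: elementary_Hom_def Delta_ract_def zero,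
            auto simp: eps_ract_def cis_mult algebra_simps)
    qed (simp_all add: elementary_Hom_def Delta_ract_def eps_ract_def)
  qed (simp_all add: elementary_Hom_def Delta_ract_def eps_ract_def)
  then show ?thesis
    by (simp add: Hom_eps_Delta_def Vector_Spaces.linear_iff vector_space_cscale)
      (simp add: elementary_Hom_def)
qed

lemma matrix_element_elementary_Hom:
  "matrix_element (elementary_Hom lam j m) l n = (if l = j \<and> n = m then 1 else 0)"
  by (simp add: matrix_element_def elementary_Hom_def lookup_single when_def)

text \<open>Up to unit scalars the matrix units are dual to the basis of S, so they detect every
  coordinate of \<open>s\<close>. This gives non-degeneracy on the S side.\<close>

lemma pairing_elementary_Hom:
  "pairing lam (elementary_Hom lam j m) s = phase lam (- (m * j)) * Poly_Mapping.lookup s (m, j)"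
proof (induction s rule: basis_induct)
  case (basis p)
  show ?case
    by (cases p) (auto simp: pairing_basis[OF elementary_Hom_in] matrix_element_elementary_Hom
        lookup_single when_def)
qed (simp_all add: pairing_add_right[OF elementary_Hom_in]
    pairing_scale_right[OF elementary_Hom_in] lookup_add algebra_simps)

lemma dual_pairing_pairing:
  "dual_pairing (fun_scale cscale) (Hom_eps_Delta lam) cscale (pairing lam)"
proof -
  have "vector_space ((*) :: complex \<Rightarrow> complex \<Rightarrow> complex)"
    by unfold_locales (simp_all add: algebra_simps)
  then have "Vector_Spaces.linear cscale (*) (pairing lam \<zeta>)" if "\<zeta> \<in> Hom_eps_Delta lam" for \<zeta>
    using that by (simp add: Vector_Spaces.linear_iff vector_space_cscale pairing_add_right
        pairing_scale_right)
  then show ?thesis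
    by (simp add: dual_pairing_def pairing_eq lookup_add fun_scale_def)
qed

lemma nondegenerate_pairing: "nondegenerate (Hom_eps_Delta lam) (pairing lam)"
  unfolding nondegenerate_def
proof (intro conjI ballI allI impI)
  fix \<zeta> assume \<zeta>: "\<zeta> \<in> Hom_eps_Delta lam" and "\<forall>v. pairing lam \<zeta> v = 0"
  then have "matrix_element \<zeta> l n = 0" for l n
    using pairing_basis[OF \<zeta>, of n l] by simp
  moreover interpret right_module_on cscale "AA_mul lam" AA_one "fun_scale cscale"
    "Hom_eps_Delta lam" "Hom_ract lam"
    by (rule right_module_Hom)
  \<comment> \<open>Lets \<open>Hom_eqI\<close> compare \<zeta> with the zero map.\<close>
  have "0 \<in> Hom_eps_Delta lam"
    using subspace_U by (rule U.subspace_0)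
  ultimately show "\<zeta> = 0"
    by (intro Hom_eqI[OF \<zeta>]) (simp_all add: matrix_element_def)
next
  fix v assume *: "\<forall>\<zeta>\<in>Hom_eps_Delta lam. pairing lam \<zeta> v = 0"
  have "Poly_Mapping.lookup v (m, j) = 0" for m j
    using *[rule_format, OF elementary_Hom_in, of j m] by (simp add: pairing_elementary_Hom)
  then show "v = 0"
    by (auto intro: poly_mapping_eqI)
qed

lemma tensorial_pairing:
  "tensorial (Hom_eps_Delta lam) (Hom_ract lam) (S_lact lam) (pairing lam)"
  unfolding tensorial_def
proof (intro ballI allI)
  fix \<zeta> v b assume \<zeta>: "\<zeta> \<in> Hom_eps_Delta lam"
  show "pairing lam (Hom_ract lam \<zeta> b) v = pairing lam \<zeta> (S_lact lam b v)"
  proof (induction b rule: basis_induct)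
    case (basis p)
    obtain m1 j1 m2 j2 where p: "p = ((m1, j1), (m2, j2))"
      by (metis surj_pair)
    show ?case
    proof (induction v rule: basis_induct)
      case (basis q)
      obtain n l where q: "q = (n, l)"
        by (cases q)
      \<comment> \<open>The negated sum collects the phases of \<open>a_{n,l}\<close> and then
        \<open>p\<close> acting on \<open>d_{0,0,0}\<close>, which give a multiple of
        \<open>d_{n+m1,m2,-l-j1-j2}\<close>; the last summand comes from
        \<open>lookup_Hom_basis\<close> at \<open>k = 0\<close>.\<close>
      have "pairing lam (Hom_ract lam \<zeta> (basis_vec p)) (basis_vec q) =
          phase lam (- (n * l + (n + m1) * j1 + m2 * j2) + m2 * (l + j1 + j2)) *
            matrix_element \<zeta> (l + j1 + j2) (n + m1 - m2)"
        by (simp add: p q pairing_eq Hom_ract_def Delta_lact_def tensor_def A_one_def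
            Hom_scale[OF \<zeta>] lookup_Hom_basis[OF \<zeta>] cis_mult cis_mult_left algebra_simps
            del: cscale_single)
      also have "\<dots> = pairing lam \<zeta> (S_lact lam (basis_vec p) (basis_vec q))"
        by (simp add: p q S_lact_def pairing_scale_right[OF \<zeta>] pairing_basis[OF \<zeta>] cis_mult cis_mult_left
            algebra_simps del: cscale_single)
      finally show ?case .
    qed (simp_all add: Hom_ract_def pairing_eq Delta_lact_def tensor_def S_lact_def
        Hom_add[OF \<zeta>] Hom_scale[OF \<zeta>] lookup_add)
  qed (simp_all add: Hom_ract_def pairing_eq Delta_lact_def tensor_def S_lact_def
      Hom_add[OF \<zeta>] Hom_scale[OF \<zeta>] lookup_add)
qed

lemma free_of_rank_one_S: "free_of_rank (\<lambda>a. S_lact lam (tensor a A_one)) 1"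
  unfolding free_of_rank_def
proof (intro exI[of _ "{basis_vec (0, 0)}"] conjI allI)
  let ?e = "basis_vec (0, 0) :: rot_S"
  fix v :: rot_S
  show "\<exists>!c. (\<forall>e. e \<notin> {?e} \<longrightarrow> c e = 0) \<and> v = (\<Sum>e\<in>{?e}. S_lact lam (tensor (c e) A_one) e)"
    \<comment> \<open>The coefficient of the generator \<open>s_{0,0}\<close> is \<open>v\<close>
      itself, read as an element of A.\<close>
    by (rule ex1I[of _ "\<lambda>e. if e = ?e then v else 0"])
      (auto simp: S_lact_tensor_one_generator)
qed simp_all

theorem theorem1:
  fixes lam :: real
  assumes "lam / (2 * pi) \<notin> \<rat>"
  shows "weak_hopfish_antipode lam cscale (S_lact lam) (pairing lam)"
  unfolding weak_hopfish_antipode_def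
  by (intro conjI left_module_S dual_pairing_pairing tensorial_pairing nondegenerate_pairing
      free_of_rank_one_S)

end
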